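(* For every integer $p\ge1$, as a power series in $u$, $$H^{(p)}(t,u,1,z)=\sum_{n=0}^\infty\frac{zt(1-u)u^n(1-t)^n}{\delta_n^p\prod_{i=1}^{n+1}\gamma_i}.$$
   Context: For a finite integer sequence $(a_1,\dots,a_i)$, $\mathrm{asc}(a_1,\dots,a_i)=|\{j:1\le j<i,\ a_j<a_{j+1}\}|$. For an integer $p\ge1$, a $p$-ascent sequence of length $n\ge1$ is a sequence $(a_1,\dots,a_n)$ of nonnegative integers with $a_1=0$ and $a_i\le p+\mathrm{asc}(a_1,\dots,a_{i-1})$ for all $2\le i\le n$. $H^{(p)}(t,u,v,z)=\sum_w t^{|w|}u^{\mathrm{asc}(w)}v^{\mathrm{last}(w)}z^{|w|_0}$, summed over all nonempty $p$-ascent sequences $w$, where $|w|$ is the length, $\mathrm{last}(w)$ the last letter and $|w|_0$ the number of zeros of $w$. Define $\delta_0=1$ and, for $k\ge1$, $\delta_k=u-(1-t)^k(u-1)$ and $\gamma_k=u-(1-zt)(1-t)^{k-1}(u-1)$. *)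

theory Defs
  imports "HOL-Computational_Algebra.Formal_Power_Series"
begin

definition asc :: "nat list \<Rightarrow> nat" where
  "asc w = card {j. Suc j < length w \<and> w ! j < w ! Suc j}"

text \<open>
  Lists are indexed from 0, so the paper's \<open>a\<^sub>i\<close> is \<open>w ! (i - 1)\<close>. The prefix preceding
  the letter \<open>w ! i\<close> is \<open>take i w\<close>.
\<close>

definition p_ascent_seq :: "nat \<Rightarrow> nat list \<Rightarrow> bool" where
  "p_ascent_seq p w \<longleftrightarrow>
     w \<noteq> [] \<and> w ! 0 = 0 \<and> (\<forall>i. 1 \<le> i \<and> i < length w \<longrightarrow> w ! i \<le> p + asc (take i w))"

text \<open>
  The generating function \<open>H\<^sup>(\<^sup>p\<^sup>)(t,u,v,z)\<close>, as a power series in \<open>u\<close> (outer series, index \<open>m\<close>)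
  whose coefficients are power series in \<open>t\<close> (inner series, index \<open>n\<close>). The coefficient of
  \<open>u\<^sup>m t\<^sup>n\<close> is a polynomial in \<open>v\<close> and \<open>z\<close> (the sum is finite, see below), so \<open>v\<close> and \<open>z\<close> can be
  any elements of a commutative coefficient ring, in particular 1 or an indeterminate.
\<close>

definition asc_gf :: "nat \<Rightarrow> 'a \<Rightarrow> 'a \<Rightarrow> 'a::comm_ring_1 fps fps" where
  "asc_gf p v z = Abs_fps (\<lambda>m. Abs_fps (\<lambda>n.
     \<Sum>w | p_ascent_seq p w \<and> length w = n \<and> asc w = m. v ^ last w * z ^ count_list w 0))"

lemma asc_le_length: "asc w \<le> length w"
proof -
  have "asc w \<le> card {..<length w}"
    unfolding asc_def by (intro card_mono) auto
  then show ?thesis by simp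
qed

lemma p_ascent_seq_letter_le:
  assumes "p_ascent_seq p w" and "x \<in> set w"
  shows "x \<le> p + length w"
proof -
  obtain i where i: "i < length w" "x = w ! i"
    using assms(2) by (auto simp: in_set_conv_nth)
  show ?thesis
  proof (cases i)
    case 0
    then show ?thesis using assms(1) i by (simp add: p_ascent_seq_def)
  next
    case (Suc k)
    then have "x \<le> p + asc (take i w)" using assms(1) i by (simp add: p_ascent_seq_def)
    moreover have "asc (take i w) \<le> length w" using asc_le_length[of "take i w"] by simp
    ultimately show ?thesis by simp
  qed
qed

lemma finite_p_ascent_seq: "finite {w. p_ascent_seq p w \<and> length w = n \<and> asc w = m}"
proof (rule finite_subset)
  show "{w. p_ascent_seq p w \<and> length w = n \<and> asc w = m} \<subseteq> {w. set w \<subseteq> {..p + n} \<and> length w = n}"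
    using p_ascent_seq_letter_le by auto
  show "finite {w. set w \<subseteq> {..p + n} \<and> length w = n}"
    by (rule finite_lists_length_eq) simp
qed

text \<open>
  The indeterminates of \<open>\<rat>[[z]][[t]][[u]]\<close>, the series in \<open>u\<close> being the outermost.
\<close>

definition var_u :: "rat fps fps fps" where
  "var_u = fps_X"

definition var_t :: "rat fps fps fps" where
  "var_t = fps_const fps_X"

definition var_z :: "rat fps fps fps" where
  "var_z = fps_const (fps_const fps_X)"

definition delta :: "nat \<Rightarrow> rat fps fps fps" where
  "delta k = (if k = 0 then 1 else var_u - (1 - var_t) ^ k * (var_u - 1))"

text \<open>Only meaningful for \<open>k \<ge> 1\<close>.\<close>

definition gamma :: "nat \<Rightarrow> rat fps fps fps" where
  "gamma k = var_u - (1 - var_z * var_t) * (1 - var_t) ^ (k - 1) * (var_u - 1)"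

text \<open>
  Every \<open>delta k\<close> and \<open>gamma k\<close> is a unit: its constant term in \<open>u\<close> is a series in \<open>t\<close> with
  constant term 1. The library's division by these series is therefore genuine division.
\<close>

lemma unit_fps_fps_fps:
  fixes f :: "rat fps fps fps"
  assumes "fps_nth (fps_nth f 0) 0 = 1"
  shows "f * inverse f = 1" and "g / f = g * inverse f"
proof -
  have rinv: "a * inverse a = 1" if "fps_nth a 0 * inverse (fps_nth a 0) = 1"
    for a :: "'a::{comm_ring_1,inverse} fps"
    unfolding fps_inverse_def using that by (rule fps_right_inverse)
  show "f * inverse f = 1"
    by (intro rinv) (simp add: assms)
  have "fps_nth f 0 \<noteq> 0" using assms by auto
  then show "g / f = g * inverse f"
    by (simp add: fps_divide_def subdegree_eq_0)
qed

lemma delta_const: "fps_nth (fps_nth (delta k) 0) 0 = 1"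
  by (simp add: delta_def var_u_def var_t_def fps_power_zeroth)

lemma gamma_const: "fps_nth (fps_nth (gamma k) 0) 0 = 1"
  by (simp add: gamma_def var_u_def var_t_def var_z_def fps_power_zeroth)

end

theory Submission
  imports Defs
begin

text \<open>
  Appending a last letter gives a kernel equation for \<open>H\<^sup>(\<^sup>p\<^sup>)(t,u,v,z)\<close>, in which the factor
  \<open>v - 1 - t v (1 - u)\<close> of the unknown series vanishes at \<open>v = 1 / \<delta>\<^sub>1\<close>. There it becomes
  \<open>\<gamma>\<^sub>1 \<delta>\<^sub>1\<^sup>p H(u) = z t (1 - u) \<delta>\<^sub>1\<^sup>p + u H(u / \<delta>\<^sub>1)\<close> for \<open>H(u) = H\<^sup>(\<^sup>p\<^sup>)(t,u,1,z)\<close>. The substitution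
  \<open>u \<mapsto> u / \<delta>\<^sub>1\<close> sends \<open>\<delta>\<^sub>k\<close> to \<open>\<delta>\<^sub>k\<^sub>+\<^sub>1 / \<delta>\<^sub>1\<close> and \<open>\<gamma>\<^sub>k\<close> to \<open>\<gamma>\<^sub>k\<^sub>+\<^sub>1 / \<delta>\<^sub>1\<close>, so iterating this equation
  produces the summands one by one, each step gaining a factor \<open>u\<close> in the remainder.

  Since \<open>1 / \<delta>\<^sub>1\<close> has a nonzero constant term, it cannot be substituted for \<open>v\<close> formally in a series
  in \<open>v\<close>. The kernel step is therefore carried out on the polynomials counting sequences of bounded
  length, with an error divisible by a high power of \<open>t\<close>.
\<close>

section \<open>Appending a last letter\<close>

lemma asc_append1:
  assumes "w \<noteq> []"
  shows "asc (w @ [x]) = asc w + (if last w < x then 1 else 0)"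
proof -
  let ?A = "{j. Suc j < length w \<and> w ! j < w ! Suc j}"
  let ?B = "if last w < x then {length w - 1} else {}"
  have "{j. Suc j < length (w @ [x]) \<and> (w @ [x]) ! j < (w @ [x]) ! Suc j} = ?A \<union> ?B"
  proof (rule set_eqI)
    fix j
    have "Suc j < length w \<or> j = length w - 1 \<or> length w \<le> j" by linarith
    then show "j \<in> {j. Suc j < length (w @ [x]) \<and> (w @ [x]) ! j < (w @ [x]) ! Suc j} \<longleftrightarrow> j \<in> ?A \<union> ?B"
      using assms by (auto simp: nth_append last_conv_nth)
  qed
  moreover have "finite ?A" by (rule finite_subset[of _ "{..<length w}"]) auto
  moreover have "?A \<inter> ?B = {}" by auto
  ultimately show ?thesis by (simp add: asc_def card_Un_disjoint)
qed

lemma p_ascent_seq_append1: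
  assumes "w \<noteq> []"
  shows "p_ascent_seq p (w @ [x]) \<longleftrightarrow> p_ascent_seq p w \<and> x \<le> p + asc w"
proof -
  have "1 \<le> length w" using assms by (simp add: Suc_le_eq)
  then have "(\<forall>i. 1 \<le> i \<and> i < Suc (length w) \<longrightarrow> Q i) \<longleftrightarrow>
      (\<forall>i. 1 \<le> i \<and> i < length w \<longrightarrow> Q i) \<and> Q (length w)" for Q
    by (auto simp: less_Suc_eq)
  then show ?thesis
    using assms by (simp add: p_ascent_seq_def nth_append cong: imp_cong conj_cong)
qed

text \<open>The bound on a letter involves only the prefix before it, and \<open>asc\<close> never
  decreases when a letter is appended. Hence the admissible new letters \<open>{..p + asc w}\<close>
  always include \<open>last w\<close> and can be split there.\<close>

lemma p_ascent_seq_last_le: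
  assumes "p_ascent_seq p w"
  shows "last w \<le> p + asc w"
proof (cases w rule: rev_cases)
  case Nil
  then show ?thesis using assms by (simp add: p_ascent_seq_def)
next
  case (snoc v x)
  show ?thesis
  proof (cases "v = []")
    case True
    then show ?thesis using assms snoc by (simp add: p_ascent_seq_def)
  next
    case False
    then show ?thesis
      using assms snoc by (simp add: p_ascent_seq_append1 asc_append1)
  qed
qed

definition p_ascent_seqs :: "nat \<Rightarrow> nat \<Rightarrow> nat list set" where
  "p_ascent_seqs p n = {w. p_ascent_seq p w \<and> length w = n}"

lemma finite_p_ascent_seqs: "finite (p_ascent_seqs p n)"
proof (rule finite_subset)
  show "p_ascent_seqs p n \<subseteq> {w. set w \<subseteq> {..p + n} \<and> length w = n}"
    using p_ascent_seq_letter_le by (auto simp: p_ascent_seqs_def)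
qed (simp add: finite_lists_length_eq)

lemma p_ascent_seqs_1: "p_ascent_seqs p 1 = {[0]}"
  by (auto simp: p_ascent_seqs_def p_ascent_seq_def length_Suc_conv)

text \<open>Turns a sum over sequences of length n + 1 into a double sum over a prefix and its new
  letter. It fails for n = 0, since \<open>[0]\<close> has no admissible prefix.\<close>

lemma bij_betw_p_ascent_seqs_Suc:
  assumes "n \<ge> 1"
  shows "bij_betw (\<lambda>(w, x). w @ [x]) (Sigma (p_ascent_seqs p n) (\<lambda>w. {..p + asc w}))
           (p_ascent_seqs p (Suc n))"
proof -
  have "w \<in> (\<lambda>(w, x). w @ [x]) ` (Sigma (p_ascent_seqs p n) (\<lambda>w. {..p + asc w}))"
    if w: "w \<in> p_ascent_seqs p (Suc n)" for w
  proof -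
    obtain v x where v: "w = v @ [x]" "length v = n"
      using w by (cases w rule: rev_cases) (auto simp: p_ascent_seqs_def)
    then have "v \<noteq> []" using assms by auto
    then show ?thesis
      using w v by (force simp: p_ascent_seqs_def p_ascent_seq_append1)
  qed
  moreover have "w @ [x] \<in> p_ascent_seqs p (Suc n)"
    if "w \<in> p_ascent_seqs p n" "x \<le> p + asc w" for w x
    using that p_ascent_seq_append1[of w p x] by (auto simp: p_ascent_seqs_def p_ascent_seq_def)
  ultimately show ?thesis
    by (auto simp: bij_betw_def inj_on_def)
qed

section \<open>Counting polynomials of fixed length\<close>

text \<open>The coefficient of t^n in H, evaluated at u = x and v = y. As a finite sum it accepts
  any ring element for y, even a series with nonzero constant term.\<close>

definition asc_poly :: "nat \<Rightarrow> 'a \<Rightarrow> nat \<Rightarrow> 'a \<Rightarrow> 'a \<Rightarrow> 'a::comm_ring_1" where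
  "asc_poly p z n x y = (\<Sum>w\<in>p_ascent_seqs p n. x ^ asc w * y ^ last w * z ^ count_list w 0)"

lemma asc_poly_1: "asc_poly p z 1 x y = z"
  by (simp add: asc_poly_def p_ascent_seqs_1 asc_def del: One_nat_def)

text \<open>Two geometric sums, since only letters above l create an ascent; the factor y - 1 avoids
  division, and (z - 1) * (y - 1) corrects the weight of the letter 0.\<close>

lemma sum_new_letter:
  fixes x y z :: "'a::comm_ring_1"
  assumes "l \<le> b"
  shows "(y - 1) * (\<Sum>k\<le>b. x ^ (if l < k then 1 else 0) * y ^ k * z ^ (if k = 0 then 1 else 0))
         = (z - 1) * (y - 1) + y * y ^ l - 1 + x * y * y ^ b - x * y * y ^ l"
proof -
  let ?f = "\<lambda>k. x ^ (if l < k then 1 else 0) * y ^ k * z ^ (if k = 0 then 1 else 0)"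
  have "(y - 1) * (\<Sum>k\<le>l. ?f k) = (z - 1) * (y - 1) + y ^ Suc l - 1"
  proof -
    have "(\<Sum>k\<le>l. ?f k) = (\<Sum>k\<le>l. y ^ k + (if k = 0 then z - 1 else 0))"
      by (intro sum.cong) auto
    also have "\<dots> = (\<Sum>k\<le>l. y ^ k) + (z - 1)"
      by (simp add: sum.distrib)
    finally have "(\<Sum>k\<le>l. ?f k) = (\<Sum>k\<le>l. y ^ k) + (z - 1)" .
    moreover have "y ^ Suc l - 1 = (y - 1) * (\<Sum>k\<le>l. y ^ k)"
      using power_diff_1_eq[of y "Suc l"] by (simp add: lessThan_Suc_atMost)
    ultimately have "(y - 1) * (\<Sum>k\<le>l. ?f k) = (z - 1) * (y - 1) + (y ^ Suc l - 1)"
      by (simp only: distrib_left ac_simps)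
    then show ?thesis by (simp only: add_diff_eq)
  qed
  moreover have "(y - 1) * (\<Sum>k\<in>{l<..b}. ?f k) = x * (y * y ^ b - y * y ^ l)"
    using assms
  proof (induction b rule: dec_induct)
    case (step b)
    then have "{l<..Suc b} = insert (Suc b) {l<..b}" by auto
    with step show ?case by (simp add: algebra_simps)
  qed simp
  moreover have "{..b} = {..l} \<union> {l<..b}" using assms by auto
  then have "sum ?f {..b} = sum ?f {..l} + sum ?f {l<..b}"
    by (simp only:) (rule sum.union_disjoint, auto)
  ultimately show ?thesis by (simp only: distrib_left) (simp add: algebra_simps)
qed

text \<open>The upper end of the geometric sum contributes y^(p + asc w + 1), and absorbing y^(asc
  w) into x^(asc w) gives the evaluation at x * y.\<close>

lemma asc_poly_Suc:
  assumes "n \<ge> 1"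
  shows "(y - 1) * asc_poly p z (Suc n) x y =
     ((z - 1) * (y - 1) - 1) * asc_poly p z n x 1 + y * (1 - x) * asc_poly p z n x y
     + x * y ^ Suc p * asc_poly p z n (x * y) 1"
proof -
  let ?wt = "\<lambda>w. x ^ asc w * z ^ count_list w 0"
  have "asc_poly p z (Suc n) x y =
    (\<Sum>(w, k)\<in>Sigma (p_ascent_seqs p n) (\<lambda>w. {..p + asc w}).
       x ^ asc (w @ [k]) * y ^ k * z ^ count_list (w @ [k]) 0)"
    unfolding asc_poly_def
    by (subst sum.reindex_bij_betw[OF bij_betw_p_ascent_seqs_Suc[OF assms], symmetric])
      (simp add: case_prod_unfold)
  also have "\<dots> = (\<Sum>w\<in>p_ascent_seqs p n. \<Sum>k\<le>p + asc w.
       x ^ asc (w @ [k]) * y ^ k * z ^ count_list (w @ [k]) 0)"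
    by (rule sum.Sigma[symmetric]) (auto simp: finite_p_ascent_seqs)
  also have "\<dots> = (\<Sum>w\<in>p_ascent_seqs p n. ?wt w *
       (\<Sum>k\<le>p + asc w. x ^ (if last w < k then 1 else 0) * y ^ k * z ^ (if k = 0 then 1 else 0)))"
    unfolding sum_distrib_left
    by (intro sum.cong refl)
      (auto simp: asc_append1 p_ascent_seqs_def p_ascent_seq_def)
  finally have "(y - 1) * asc_poly p z (Suc n) x y = (\<Sum>w\<in>p_ascent_seqs p n. ?wt w *
      ((y - 1) * (\<Sum>k\<le>p + asc w. x ^ (if last w < k then 1 else 0) * y ^ k * z ^ (if k = 0 then 1 else 0))))"
    by (simp only: sum_distrib_left mult.left_commute)
  also have "\<dots> = (\<Sum>w\<in>p_ascent_seqs p n. ?wt w *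
      ((z - 1) * (y - 1) + y * y ^ last w - 1 + x * y * y ^ (p + asc w) - x * y * y ^ last w))"
    by (intro sum.cong refl arg_cong2[where f = "(*)"] sum_new_letter p_ascent_seq_last_le)
      (simp add: p_ascent_seqs_def)
  also have "\<dots> = ((z - 1) * (y - 1) - 1) * asc_poly p z n x 1 + y * (1 - x) * asc_poly p z n x y
     + x * y ^ Suc p * asc_poly p z n (x * y) 1"
    unfolding asc_poly_def sum_distrib_left sum.distrib[symmetric]
    by (intro sum.cong refl) (simp add: algebra_simps power_add power_mult_distrib)
  finally show ?thesis .
qed

section \<open>Truncation in t\<close>

lemma sum_fps_const: "(\<Sum>i\<in>A. fps_const (f i)) = fps_const (\<Sum>i\<in>A. f i)"
  by (induction A rule: infinite_finite_induct) simp_all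

lemma nth_asc_poly:
  "fps_nth (asc_poly p var_z n var_u 1) m =
     fps_const (\<Sum>w | p_ascent_seq p w \<and> length w = n \<and> asc w = m. fps_X ^ count_list w 0)"
proof -
  have "fps_nth (asc_poly p var_z n var_u 1) m =
      (\<Sum>w\<in>p_ascent_seqs p n. if asc w = m then fps_const (fps_X ^ count_list w 0) else 0)"
    by (auto simp: asc_poly_def fps_sum_nth var_u_def var_z_def fps_const_power fps_X_power_mult_nth
        intro!: sum.cong)
  also have "\<dots> = (\<Sum>w | p_ascent_seq p w \<and> length w = n \<and> asc w = m. fps_const (fps_X ^ count_list w 0))"
    by (subst sum.inter_filter[symmetric, OF finite_p_ascent_seqs])
      (simp add: p_ascent_seqs_def conj_assoc)
  also have "\<dots> = fps_const (\<Sum>w | p_ascent_seq p w \<and> length w = n \<and> asc w = m. fps_X ^ count_list w 0)"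
    by (rule sum_fps_const)
  finally show ?thesis .
qed

lemma asc_gf_truncate:
  "var_t ^ Suc N dvd asc_gf p 1 fps_X - (\<Sum>n=1..N. var_t ^ n * asc_poly p var_z n var_u 1)"
proof
  \<comment> \<open>The quotient is found coefficientwise in u, by shifting away the powers of t up
    to N. Length 0 contributes nothing, so the sum may start at 1.\<close>
  show "asc_gf p 1 fps_X - (\<Sum>n=1..N. var_t ^ n * asc_poly p var_z n var_u 1) =
    var_t ^ Suc N * Abs_fps (\<lambda>m. fps_shift (Suc N) (fps_nth (asc_gf p 1 fps_X) m))"
    (is "?l = ?r")
  proof (rule fps_ext, rule fps_ext)
    fix m n
    have empty: "{w. p_ascent_seq p w \<and> w = [] \<and> asc w = m} = {}"
      by (auto simp: p_ascent_seq_def)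
    define s where "s k = (\<Sum>w | p_ascent_seq p w \<and> length w = k \<and> asc w = m. (fps_X :: rat fps) ^ count_list w 0)" for k
    have s0: "s 0 = 0" by (simp add: s_def empty)
    have "fps_nth (fps_nth (\<Sum>n=1..N. var_t ^ n * asc_poly p var_z n var_u 1) m) n =
      (\<Sum>k=1..N. if n = k then s k else 0)"
      unfolding fps_sum_nth
      by (intro sum.cong refl) (simp add: var_t_def nth_asc_poly s_def)
    also have "\<dots> = (if n \<in> {1..N} then s n else 0)"
      by (rule sum.delta') simp
    finally have "fps_nth (fps_nth ?l m) n = (if n \<le> N then 0 else s n)"
      using s0 by (cases n) (auto simp: asc_gf_def s_def)
    also have "\<dots> = fps_nth (fps_nth ?r m) n"
      by (simp add: asc_gf_def var_t_def fps_X_power_mult_nth s_def not_le Suc_le_eq del: power_Suc)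
    finally show "fps_nth (fps_nth ?l m) n = fps_nth (fps_nth ?r m) n" .
  qed
qed

lemma eq_0_if_var_t_powers_dvd:
  assumes "\<And>N. var_t ^ N dvd f"
  shows "f = 0"
proof (rule fps_ext, rule fps_ext)
  fix m n
  obtain g where "f = var_t ^ Suc n * g" using assms by blast
  then show "fps_nth (fps_nth f m) n = fps_nth (fps_nth 0 m) n"
    by (simp add: var_t_def fps_const_power fps_X_power_mult_nth del: power_Suc)
qed

section \<open>The kernel method and the functional equation\<close>

definition kernel_root :: "rat fps fps fps" where
  "kernel_root = inverse (delta 1)"

lemma delta_kernel_root: "delta 1 * kernel_root = 1"
  unfolding kernel_root_def by (rule unit_fps_fps_fps) (rule delta_const)

lemma delta_Suc: "delta (Suc k) = var_u - (1 - var_t) ^ Suc k * (var_u - 1)"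
  by (simp add: delta_def)

lemma kernel_root_diff_1: "kernel_root - 1 = var_t * (1 - var_u) * kernel_root"
proof -
  have "kernel_root - 1 = (1 - delta 1) * kernel_root"
    using delta_kernel_root by (simp add: algebra_simps)
  also have "1 - delta 1 = var_t * (1 - var_u)"
    by (simp add: delta_def algebra_simps)
  finally show ?thesis .
qed

text \<open>The argument has no constant term in u, so this composition is a ring homomorphism; it
  fixes t and z.\<close>

definition usubst :: "rat fps fps fps \<Rightarrow> rat fps fps fps" where
  "usubst f = f oo (var_u * kernel_root)"

lemma nth_0_var_u_mult: "fps_nth (var_u * f) 0 = 0"
  by (simp add: var_u_def)

lemma usubst_simps:
  "usubst (f + g) = usubst f + usubst g"
  "usubst (f - g) = usubst f - usubst g"
  "usubst (f * g) = usubst f * usubst g"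
  "usubst (f ^ n) = usubst f ^ n"
  "usubst (sum h A) = (\<Sum>i\<in>A. usubst (h i))"
  "usubst (prod h A) = (\<Prod>i\<in>A. usubst (h i))"
  "usubst 1 = 1" "usubst var_u = var_u * kernel_root"
  "usubst var_t = var_t" "usubst var_z = var_z"
  unfolding usubst_def
  by (simp_all only: fps_compose_add_distrib fps_compose_sub_distrib
      fps_compose_mult_distrib[OF nth_0_var_u_mult] fps_compose_power[OF nth_0_var_u_mult]
      fps_compose_sum_distrib fps_compose_prod_distrib[OF nth_0_var_u_mult] fps_compose_1)
    (simp_all add: var_t_def var_z_def var_u_def)

lemma usubst_dvd: "f dvd g \<Longrightarrow> usubst f dvd usubst g"
  by (auto simp: usubst_simps elim!: dvdE)

lemma usubst_asc_poly:
  "usubst (asc_poly p var_z n var_u 1) = asc_poly p var_z n (var_u * kernel_root) 1"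
  by (simp add: asc_poly_def usubst_simps)

text \<open>
  At \<open>y = kernel_root\<close> the factor \<open>y - 1\<close> equals \<open>t y (1 - u)\<close>, so the recurrence over the length
  telescopes after multiplication by \<open>t\<^sup>n\<close>.
\<close>

lemma kernel_recurrence:
  fixes p N
  defines "A \<equiv> \<Sum>n=1..N. var_t ^ n * asc_poly p var_z n var_u 1"
  shows "gamma 1 * delta 1 ^ p * A + delta 1 ^ Suc p * var_t ^ Suc N *
           (kernel_root * (1 - var_u) * asc_poly p var_z (Suc N) var_u kernel_root) =
         var_z * var_t * (1 - var_u) * delta 1 ^ p + var_u * usubst A"
proof -
  \<comment> \<open>With this scaling, at y = \<open>kernel_root\<close> the left side of the length
    recurrence is t * Q (n + 1) and its middle term on the right is Q n.\<close>
  define Q where "Q n = kernel_root * (1 - var_u) * asc_poly p var_z n var_u kernel_root" for n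
  define c where "c = (var_z - 1) * (kernel_root - 1) - 1"
  have step: "var_t * Q (Suc n) = c * asc_poly p var_z n var_u 1 + Q n
      + var_u * kernel_root ^ Suc p * usubst (asc_poly p var_z n var_u 1)" if "n \<ge> 1" for n
  proof -
    have "var_t * Q (Suc n) = (kernel_root - 1) * asc_poly p var_z (Suc n) var_u kernel_root"
      unfolding Q_def kernel_root_diff_1 by (simp add: ac_simps)
    then show ?thesis
      unfolding asc_poly_Suc[OF that] c_def Q_def usubst_asc_poly by (simp add: ac_simps)
  qed
  have "var_t ^ Suc N * Q (Suc N) = var_t * Q 1 + c * A + var_u * kernel_root ^ Suc p * usubst A"
    unfolding A_def
  proof (induction N)
    case (Suc N)
    have "var_t ^ Suc (Suc N) * Q (Suc (Suc N)) = var_t ^ Suc N * (var_t * Q (Suc (Suc N)))"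
      by simp
    also have "\<dots> = var_t ^ Suc N * Q (Suc N) + var_t ^ Suc N * (c * asc_poly p var_z (Suc N) var_u 1
        + var_u * kernel_root ^ Suc p * usubst (asc_poly p var_z (Suc N) var_u 1))"
      by (subst step) (simp_all add: algebra_simps)
    finally show ?case
      unfolding Suc by (simp add: usubst_simps algebra_simps)
  qed (simp add: usubst_simps usubst_def)
  moreover have "Q 1 = kernel_root * (1 - var_u) * var_z"
    by (simp only: Q_def asc_poly_1)
  \<comment> \<open>The power p + 1 clears every \<open>kernel_root\<close>.\<close>
  ultimately have "delta 1 ^ Suc p * (var_t ^ Suc N * Q (Suc N)) =
      delta 1 ^ p * var_t * (1 - var_u) * var_z * (delta 1 * kernel_root) + delta 1 ^ p * A * (delta 1 * c)
      + var_u * (delta 1 ^ Suc p * kernel_root ^ Suc p) * usubst A"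
    by (simp only: distrib_left power_Suc ac_simps)
  moreover have "delta 1 * c = - gamma 1"
  proof -
    have "delta 1 * c = (var_z - 1) * (delta 1 * kernel_root - delta 1) - delta 1"
      by (simp add: c_def algebra_simps)
    then show ?thesis
      unfolding delta_kernel_root by (simp add: delta_def gamma_def algebra_simps)
  qed
  moreover have "delta 1 ^ Suc p * kernel_root ^ Suc p = 1"
    by (simp only: power_mult_distrib[symmetric] delta_kernel_root power_one)
  ultimately have "delta 1 ^ Suc p * (var_t ^ Suc N * Q (Suc N)) =
      delta 1 ^ p * var_t * (1 - var_u) * var_z - delta 1 ^ p * A * gamma 1 + var_u * usubst A"
    by (simp only: delta_kernel_root) simp
  then show ?thesis
    unfolding Q_def[symmetric] by (simp add: ac_simps del: power_Suc)
qed

text \<open>Replacing H by its truncation changes both sides by multiples of t^(N + 1), because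
  \<open>usubst\<close> fixes t. The error in the kernel recurrence is such a multiple too, and N is
  arbitrary.\<close>

lemma asc_gf_functional_equation:
  "gamma 1 * delta 1 ^ p * asc_gf p 1 fps_X =
     var_z * var_t * (1 - var_u) * delta 1 ^ p + var_u * usubst (asc_gf p 1 fps_X)"
proof -
  let ?H = "asc_gf p 1 (fps_X :: rat fps)"
  have "var_t ^ N dvd gamma 1 * delta 1 ^ p * ?H -
      (var_z * var_t * (1 - var_u) * delta 1 ^ p + var_u * usubst ?H)" for N
  proof -
    define A where "A = (\<Sum>n=1..N. var_t ^ n * asc_poly p var_z n var_u 1)"
    define Q where "Q = kernel_root * (1 - var_u) * asc_poly p var_z (Suc N) var_u kernel_root"
    have d: "var_t ^ Suc N dvd ?H - A"
      unfolding A_def by (rule asc_gf_truncate)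
    then have d': "var_t ^ Suc N dvd usubst ?H - usubst A"
      using usubst_dvd[OF d] by (simp only: usubst_simps)
    have "gamma 1 * delta 1 ^ p * ?H -
      (var_z * var_t * (1 - var_u) * delta 1 ^ p + var_u * usubst ?H) =
      gamma 1 * delta 1 ^ p * (?H - A) - var_u * (usubst ?H - usubst A)
      - var_t ^ Suc N * (delta 1 ^ Suc p * Q)"
    proof -
      have "a * h - (b + x * k) = a * (h - r) - x * (k - s) - e * (d * q)"
        if "a * r + d * e * q = b + x * s" for a b d e h k q r s x :: "rat fps fps fps"
      proof -
        have "b = a * r + d * e * q - x * s" using that by simp
        then show ?thesis by (simp add: algebra_simps)
      qed
      from this[OF kernel_recurrence[of p N, folded A_def Q_def]] show ?thesis .
    qed
    moreover have "var_t ^ Suc N dvd \<dots>"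
      by (intro dvd_diff dvd_mult d d' dvd_triv_left)
    ultimately have "var_t ^ Suc N dvd gamma 1 * delta 1 ^ p * ?H -
        (var_z * var_t * (1 - var_u) * delta 1 ^ p + var_u * usubst ?H)"
      by (simp only:)
    moreover have "var_t ^ N dvd var_t ^ Suc N" by (simp only: power_Suc2 dvd_triv_left)
    ultimately show ?thesis by (rule dvd_trans[rotated])
  qed
  then show ?thesis
    using eq_0_if_var_t_powers_dvd by (simp only: eq_iff_diff_eq_0[of "gamma 1 * delta 1 ^ p * ?H"])
qed

section \<open>The substitution acting on the summands\<close>

text \<open>Under the substitution, u - 1 times \<open>delta 1\<close> becomes u -
  \<open>delta 1\<close> = (1 - t) * (u - 1), which supplies one more factor 1 - t.\<close>

lemma delta_usubst: "delta 1 * usubst (delta k) = delta (Suc k)"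
proof (cases k)
  case 0
  then show ?thesis by (simp add: delta_def[of 0] usubst_simps)
next
  case (Suc j)
  have "delta 1 * usubst (delta k) =
      var_u * (delta 1 * kernel_root) - (1 - var_t) ^ k * (var_u * (delta 1 * kernel_root) - delta 1)"
    unfolding Suc delta_Suc usubst_simps by (simp add: algebra_simps)
  also have "\<dots> = delta (Suc k)"
    unfolding delta_kernel_root by (simp add: delta_def algebra_simps)
  finally show ?thesis .
qed

lemma gamma_usubst: "delta 1 * usubst (gamma (Suc k)) = gamma (Suc (Suc k))"
proof -
  have "delta 1 * usubst (gamma (Suc k)) =
      var_u * (delta 1 * kernel_root)
      - (1 - var_z * var_t) * (1 - var_t) ^ k * (var_u * (delta 1 * kernel_root) - delta 1)"
    unfolding gamma_def usubst_simps by (simp add: algebra_simps)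
  also have "\<dots> = gamma (Suc (Suc k))"
    unfolding delta_kernel_root by (simp add: delta_def gamma_def algebra_simps)
  finally show ?thesis .
qed

text \<open>Numerator and denominator are kept apart so that the substitution only meets products;
  the quotient is recovered by cross-multiplication.\<close>

definition summand_num :: "nat \<Rightarrow> rat fps fps fps" where
  "summand_num n = var_z * var_t * (1 - var_u) * var_u ^ n * (1 - var_t) ^ n"

definition summand_den :: "nat \<Rightarrow> nat \<Rightarrow> rat fps fps fps" where
  "summand_den p n = delta n ^ p * (\<Prod>i=1..n+1. gamma i)"

definition summand :: "nat \<Rightarrow> nat \<Rightarrow> rat fps fps fps" where
  "summand p n = summand_num n / summand_den p n"

lemma nth_0_nth_0_prod:
  "fps_nth (fps_nth (prod f A) 0) 0 = (\<Prod>i\<in>A. fps_nth (fps_nth (f i) 0) 0)"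
  by (induction A rule: infinite_finite_induct) simp_all

lemma summand_den_const: "fps_nth (fps_nth (summand_den p n) 0) 0 = 1"
  by (simp add: summand_den_def fps_power_zeroth delta_const gamma_const nth_0_nth_0_prod)

lemma summand_mult_den: "summand p n * summand_den p n = summand_num n"
  using unit_fps_fps_fps[OF summand_den_const[of p n]]
  by (simp add: summand_def ac_simps)

text \<open>Of the n + 1 factors \<open>delta 1\<close>, n are absorbed by u^n and one by 1 -
  u.\<close>

lemma usubst_summand_num:
  "var_u * (delta 1 ^ Suc n * usubst (summand_num n)) = summand_num (Suc n)"
proof -
  have "delta 1 * usubst (1 - var_u) = (1 - var_t) * (1 - var_u)"
  proof -
    have "delta 1 * usubst (1 - var_u) = delta 1 - var_u * (delta 1 * kernel_root)"
      by (simp add: usubst_simps algebra_simps)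
    then show ?thesis
      unfolding delta_kernel_root by (simp add: delta_def algebra_simps)
  qed
  moreover have "delta 1 ^ n * usubst var_u ^ n = var_u ^ n"
    by (simp only: usubst_simps power_mult_distrib[symmetric] mult.left_commute[of "delta 1"]
        delta_kernel_root mult_1_right)
  moreover have "usubst (summand_num n) =
      var_z * var_t * usubst (1 - var_u) * usubst var_u ^ n * (1 - var_t) ^ n"
    by (simp add: summand_num_def usubst_simps)
  then have "var_u * (delta 1 ^ Suc n * usubst (summand_num n)) =
      var_z * var_t * var_u * (delta 1 * usubst (1 - var_u)) *
      (delta 1 ^ n * usubst var_u ^ n) * (1 - var_t) ^ n"
    by (simp only: power_Suc ac_simps)
  ultimately show ?thesis
    by (simp only: summand_num_def power_Suc ac_simps)
qed

text \<open>Here p factors \<open>delta 1\<close> serve the power of \<open>delta n\<close> and n +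
  1 the product; the shifted product lacks \<open>gamma 1\<close>, which is supplied in
  front.\<close>

lemma usubst_summand_den:
  "gamma 1 * (delta 1 ^ p * delta 1 ^ Suc n * usubst (summand_den p n)) = summand_den p (Suc n)"
proof -
  have "delta 1 ^ p * usubst (delta n ^ p) = delta (Suc n) ^ p"
    by (simp only: usubst_simps power_mult_distrib[symmetric] delta_usubst)
  moreover have "delta 1 ^ Suc n * usubst (\<Prod>i=1..n+1. gamma i) = (\<Prod>i=1..n+1. gamma (Suc i))"
  proof -
    have "delta 1 ^ Suc n * usubst (\<Prod>i=1..n+1. gamma i) = (\<Prod>i=1..n+1. delta 1 * usubst (gamma i))"
      by (simp add: usubst_simps prod.distrib)
    also have "\<dots> = (\<Prod>i=1..n+1. gamma (Suc i))"
      using gamma_usubst by (intro prod.cong refl) (metis atLeastAtMost_iff Suc_le_D One_nat_def)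
    finally show ?thesis .
  qed
  moreover have "(\<Prod>i=1..Suc n+1. gamma i) = gamma 1 * (\<Prod>i=1..n+1. gamma (Suc i))"
    using prod.atLeast_Suc_atMost[of 1 "Suc n + 1" gamma]
      prod.shift_bounds_cl_Suc_ivl[of gamma 1 "n + 1"]
    by (simp del: prod.cl_ivl_Suc)
  moreover have "gamma 1 * (delta 1 ^ p * delta 1 ^ Suc n * usubst (summand_den p n)) =
      gamma 1 * ((delta 1 ^ p * usubst (delta n ^ p)) * (delta 1 ^ Suc n * usubst (\<Prod>i=1..n+1. gamma i)))"
    by (simp only: summand_den_def usubst_simps(3) ac_simps)
  ultimately show ?thesis
    by (simp only: summand_den_def ac_simps)
qed

text \<open>Numerator and denominator share n + 1 factors \<open>delta 1\<close>; after cancellation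
  the coefficient is that of H in the functional equation.\<close>

lemma summand_Suc:
  "gamma 1 * delta 1 ^ p * summand p (Suc n) = var_u * usubst (summand p n)"
proof -
  have "usubst (summand p n) * usubst (summand_den p n) = usubst (summand_num n)"
    using summand_mult_den[of p n] usubst_simps(3) by metis
  then have "gamma 1 * delta 1 ^ p * (summand p (Suc n) * summand_den p (Suc n)) =
      gamma 1 * delta 1 ^ p * (var_u * (delta 1 ^ Suc n * (usubst (summand p n) * usubst (summand_den p n))))"
    by (simp only: summand_mult_den usubst_summand_num)
  also have "\<dots> = var_u * usubst (summand p n) *
      (gamma 1 * (delta 1 ^ p * delta 1 ^ Suc n * usubst (summand_den p n)))"
    by (simp only: ac_simps)
  finally have "gamma 1 * delta 1 ^ p * summand p (Suc n) * summand_den p (Suc n) =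
      var_u * usubst (summand p n) * summand_den p (Suc n)"
    unfolding usubst_summand_den by (simp only: mult.assoc)
  moreover have "summand_den p (Suc n) \<noteq> 0"
    using summand_den_const[of p "Suc n"] by auto
  ultimately show ?thesis by simp
qed

lemma summand_0: "gamma 1 * summand p 0 = var_z * var_t * (1 - var_u)"
  using summand_mult_den[of p 0]
  by (simp add: summand_num_def summand_den_def delta_def ac_simps)

lemma dvd_cancel_unit:
  fixes x :: "'a::comm_monoid_mult"
  assumes "d dvd c * x" and "c * e = 1"
  shows "d dvd x"
proof -
  have "d dvd e * (c * x)" using assms(1) by (rule dvd_mult)
  also have "e * (c * x) = (c * e) * x" by (simp only: ac_simps)
  finally show ?thesis by (simp only: assms(2) mult_1_left)
qed

section \<open>Convergence in u\<close>

text \<open>Up to a unit, each remainder is u times the substituted previous one, and the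
  substitution sends u to a multiple of u.\<close>

lemma asc_gf_remainder: "var_u ^ N dvd asc_gf p 1 fps_X - (\<Sum>n<N. summand p n)"
proof (induction N)
  case (Suc N)
  let ?H = "asc_gf p 1 (fps_X :: rat fps)"
  let ?c = "gamma 1 * delta 1 ^ p"
  have "?c * (\<Sum>n<Suc N. summand p n) =
      delta 1 ^ p * (gamma 1 * summand p 0) + (\<Sum>n<N. ?c * summand p (Suc n))"
    by (simp add: sum.lessThan_Suc_shift sum_distrib_left distrib_left ac_simps
        del: sum.lessThan_Suc)
  then have "?c * (?H - (\<Sum>n<Suc N. summand p n)) = var_u * usubst (?H - (\<Sum>n<N. summand p n))"
    unfolding right_diff_distrib asc_gf_functional_equation summand_Suc summand_0
    by (simp add: usubst_simps sum_distrib_left[symmetric] algebra_simps)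
  moreover have "var_u ^ N dvd usubst (?H - (\<Sum>n<N. summand p n))"
    using usubst_dvd[OF Suc.IH] by (simp add: usubst_simps power_mult_distrib dvd_mult_left)
  ultimately have dvd: "var_u ^ Suc N dvd ?c * (?H - (\<Sum>n<Suc N. summand p n))"
    by (simp add: mult_dvd_mono)
  have "?c * inverse ?c = 1"
    by (rule unit_fps_fps_fps) (simp add: fps_power_zeroth delta_const gamma_const)
  with dvd show ?case
    by (rule dvd_cancel_unit)
qed simp

theorem theorem3p2:
  fixes p :: nat
  assumes "p \<ge> 1"
  shows "(\<lambda>n. var_z * var_t * (1 - var_u) * var_u ^ n * (1 - var_t) ^ n
            / (delta n ^ p * (\<Prod>i=1..n+1. gamma i)))
         sums asc_gf p 1 (fps_X :: rat fps)"
proof -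
  have "(\<lambda>N. \<Sum>n<N. summand p n) \<longlonglongrightarrow> asc_gf p 1 fps_X"
  proof (rule tendsto_fpsI)
    fix m
    \<comment> \<open>A remainder divisible by u^N cannot affect the coefficient of u^m once N >
      m.\<close>
    have "fps_nth (\<Sum>n<N. summand p n) m = fps_nth (asc_gf p 1 fps_X) m" if "N > m" for N
    proof -
      obtain g where "asc_gf p 1 fps_X - (\<Sum>n<N. summand p n) = var_u ^ N * g"
        using asc_gf_remainder by blast
      then have "fps_nth (asc_gf p 1 fps_X - (\<Sum>n<N. summand p n)) m = 0"
        using that by (simp only: var_u_def fps_X_power_mult_nth) simp
      then show ?thesis by simp
    qed
    then show "\<forall>\<^sub>F N in sequentially. fps_nth (\<Sum>n<N. summand p n) m = fps_nth (asc_gf p 1 fps_X) m"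
      using eventually_gt_at_top by (rule eventually_mono[rotated])
  qed
  then show ?thesis
    by (simp only: sums_def summand_def summand_num_def summand_den_def)
qed

end
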